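(* Let $(C,Z,\models)$ and $(C,Z',\models')$ be concept-class triples with the same concept class $C$ such that $Z\subseteq Z'$ and, for all $c\in C$ and $z\in Z$, $c\models z$ if and only if $c\models' z$. Then for each sampling mode $(\alpha,\beta)\in\{O,\overline{O}\}\times\{R,\overline{R}\}$, $$\mathrm{MAP\text{-}TD}^{\alpha,\beta}(C,Z,\models)\ \ge\ \mathrm{MAP\text{-}TD}^{\alpha,\beta}(C,Z',\models').$$
   Context: A concept-class triple $(C,Z,\models)$ consists of a finite set $C$ with $|C|\ge 2$ (the concept class), a non-empty finite set $Z$ (the observations) and a relation $\models$ on $C\times Z$ (consistency). Sampling modes are pairs $(\alpha,\beta)\in\{O,\overline{O}\}\times\{R,\overline{R}\}$ (ordered/unordered, with/without replacement). $\mathcal{Z}^{O,R}$ is the set of finite sequences over $Z$; $\mathcal{Z}^{\overline{O},R}$ the set of finite multisets over $Z$; $\mathcal{Z}^{O,\overline{R}}$ the set of repetition-free sequences over $Z$; $\mathcal{Z}^{\overline{O},\overline{R}}=2^Z$. The empty sequence/multiset/set is included and denoted $\emptyset$; $|I|$ is the length of a sequence or the cardinality (with multiplicity) of a (multi)set. For a probability vector $Q=(q(z))_{z\in Z}$: $P^{O,R}((z_1,\dots,z_n)|Q)=\prod_{i=1}^n q(z_i)$; for a multiset $A$ of size $n$ with distinct elements $z'_1,\dots,z'_k$ of multiplicities $n_1,\dots,n_k$, $P^{\overline{O},R}(A|Q)=\frac{n!}{n_1!\cdots n_k!}\prod_{i=1}^k q(z'_i)^{n_i}$; for a repetition-free sequence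 with $n\le|\{z:q(z)>0\}|$, $P^{O,\overline{R}}((z_1,\dots,z_n)|Q)=\prod_{i=1}^n \frac{q(z_i)}{1-(q(z_1)+\dots+q(z_{i-1}))}$; for a set $A=\{z_1,\dots,z_n\}$ of size $n\le|\{z:q(z)>0\}|$, $P^{\overline{O},\overline{R}}(A|Q)=\sum_\sigma P^{O,\overline{R}}((z_{\sigma(1)},\dots,z_{\sigma(n)})|Q)$ over all permutations $\sigma$ of $\{1,\dots,n\}$. The probability of $\emptyset$ is $1$ in every mode. A MAP-learner $L$ for $(C,Z,\models)$ is given by priors $P(c)>0$ with $\sum_{c\in C}P(c)=1$ and conditional likelihoods $P(z|c)\ge 0$ with $\sum_{z\in Z}P(z|c)=1$ for each $c\in C$, subject to the validity condition: $c\not\models z$ implies $P(z|c)=0$. Write $P^{\alpha,\beta}(I|c)$ for $P^{\alpha,\beta}(I|P(\cdot|c))$ and $N^+(C,L)=\min_{c\in C}|\{z\in Z:P(z|c)>0\}|$. A teacher for $L$ in mode $(\alpha,\beta)$ is a map $T:C\to\mathcal{Z}^{\alpha,\beta}$ such that for every $c_0\in C$: if $\beta=\overline{R}$ then $|T(c_0)|\le N^+(C,L)$; and $c_0$ is the unique maximizer over $c\in C$ of $P(c)\cdot P^{\alpha,\beta}(T(c_0)|c)$. The order of $T$ is $\max_{c\in C}|T(c)|$. $\mathrm{MAP\text{-}TD}^{\alpha,\beta}_L(C,Z,\models)$ is the smallest order of a teacher for $L$ in mode $(\alpha,\beta)$, or $\infty$ if no teacher exists. $\mathrm{MAP\text{-}TD}^{\alpha,\beta}(C,Z,\models)=\min_L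 \mathrm{MAP\text{-}TD}^{\alpha,\beta}_L(C,Z,\models)$ with $L$ ranging over all MAP-learners for $(C,Z,\models)$. *)

theory Defs
  imports Complex_Main "HOL-Library.Multiset" "HOL-Library.Extended_Nat"
    "HOL-Combinatorics.Multiset_Permutations"
begin

definition concept_class_triple :: "'c set \<Rightarrow> 'z set \<Rightarrow> ('c \<times> 'z) set \<Rightarrow> bool" where
  "concept_class_triple C Z R \<longleftrightarrow>
     finite C \<and> 2 \<le> card C \<and> finite Z \<and> Z \<noteq> {} \<and> R \<subseteq> C \<times> Z"

datatype ordering = Ordered | Unordered
datatype replacement = With_Repl | Without_Repl

text \<open>One carrier type for the samples of all four modes: sequences serve both ordered modes,
  multisets the unordered mode with replacement, sets the unordered mode without replacement.\<close>

datatype 'z sample = Seq "'z list" | Bag "'z multiset" | Subset "'z set"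

fun sample_size :: "'z sample \<Rightarrow> nat" where
  "sample_size (Seq zs) = length zs"
| "sample_size (Bag A) = size A"
| "sample_size (Subset A) = card A"

fun samples :: "ordering \<Rightarrow> replacement \<Rightarrow> 'z set \<Rightarrow> 'z sample set" where
  "samples Ordered With_Repl Z = {Seq zs | zs. set zs \<subseteq> Z}"
| "samples Unordered With_Repl Z = {Bag A | A. set_mset A \<subseteq> Z}"
| "samples Ordered Without_Repl Z = {Seq zs | zs. set zs \<subseteq> Z \<and> distinct zs}"
| "samples Unordered Without_Repl Z = {Subset A | A. A \<subseteq> Z}"

definition prob_seq_repl :: "('z \<Rightarrow> real) \<Rightarrow> 'z list \<Rightarrow> real" where
  "prob_seq_repl q zs = (\<Prod>i<length zs. q (zs ! i))"

definition prob_mset_repl :: "('z \<Rightarrow> real) \<Rightarrow> 'z multiset \<Rightarrow> real" where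
  "prob_mset_repl q A =
     fact (size A) / (\<Prod>z\<in>set_mset A. fact (count A z)) * (\<Prod>z\<in>set_mset A. q z ^ count A z)"

text \<open>The next two probabilities are only meaningful for samples whose size is at most the
  size of the support of \<open>q\<close> (then no denominator vanishes). Teachers are required below
  to respect this bound.\<close>

definition prob_seq_norepl :: "('z \<Rightarrow> real) \<Rightarrow> 'z list \<Rightarrow> real" where
  "prob_seq_norepl q zs = (\<Prod>i<length zs. q (zs ! i) / (1 - (\<Sum>j<i. q (zs ! j))))"

definition prob_set_norepl :: "('z \<Rightarrow> real) \<Rightarrow> 'z set \<Rightarrow> real" where
  "prob_set_norepl q A = (\<Sum>zs\<in>permutations_of_set A. prob_seq_norepl q zs)"

text \<open>Unspecified on samples that do not belong to the given mode.\<close>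

fun sample_prob :: "ordering \<Rightarrow> replacement \<Rightarrow> ('z \<Rightarrow> real) \<Rightarrow> 'z sample \<Rightarrow> real" where
  "sample_prob Ordered With_Repl q (Seq zs) = prob_seq_repl q zs"
| "sample_prob Unordered With_Repl q (Bag A) = prob_mset_repl q A"
| "sample_prob Ordered Without_Repl q (Seq zs) = prob_seq_norepl q zs"
| "sample_prob Unordered Without_Repl q (Subset A) = prob_set_norepl q A"

text \<open>\<open>lik L c z\<close> is the conditional likelihood $P(z|c)$. The values of \<open>prior\<close> and
  \<open>lik\<close> outside the concept class and the observations are irrelevant.\<close>

record ('c, 'z) learner =
  prior :: "'c \<Rightarrow> real"
  lik :: "'c \<Rightarrow> 'z \<Rightarrow> real"

definition MAP_learner ::
  "'c set \<Rightarrow> 'z set \<Rightarrow> ('c \<times> 'z) set \<Rightarrow> ('c, 'z) learner \<Rightarrow> bool" where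
  "MAP_learner C Z R L \<longleftrightarrow>
     (\<forall>c\<in>C. prior L c > 0) \<and> (\<Sum>c\<in>C. prior L c) = 1 \<and>
     (\<forall>c\<in>C. (\<forall>z\<in>Z. lik L c z \<ge> 0) \<and> (\<Sum>z\<in>Z. lik L c z) = 1) \<and>
     (\<forall>c\<in>C. \<forall>z\<in>Z. (c, z) \<notin> R \<longrightarrow> lik L c z = 0)"

definition N_plus :: "'c set \<Rightarrow> 'z set \<Rightarrow> ('c, 'z) learner \<Rightarrow> nat" where
  "N_plus C Z L = Min ((\<lambda>c. card {z\<in>Z. lik L c z > 0}) ` C)"

definition teacher ::
  "ordering \<Rightarrow> replacement \<Rightarrow> 'c set \<Rightarrow> 'z set \<Rightarrow> ('c, 'z) learner \<Rightarrow> ('c \<Rightarrow> 'z sample) \<Rightarrow> bool" where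
  "teacher \<alpha> \<beta> C Z L T \<longleftrightarrow>
     (\<forall>c\<^sub>0\<in>C. T c\<^sub>0 \<in> samples \<alpha> \<beta> Z \<and>
        (\<beta> = Without_Repl \<longrightarrow> sample_size (T c\<^sub>0) \<le> N_plus C Z L) \<and>
        {c. is_arg_max (\<lambda>c. prior L c * sample_prob \<alpha> \<beta> (lik L c) (T c\<^sub>0)) (\<lambda>c. c \<in> C) c}
          = {c\<^sub>0})"

definition teacher_order :: "'c set \<Rightarrow> ('c \<Rightarrow> 'z sample) \<Rightarrow> nat" where
  "teacher_order C T = Max ((\<lambda>c. sample_size (T c)) ` C)"

text \<open>In \<^typ>\<open>enat\<close> the infimum of a non-empty set is its least element, and
  the infimum of the empty set is \<open>\<infinity>\<close>. In particular \<open>MAP_TD\<close> is \<open>\<infinity>\<close> if there is no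
  MAP-learner at all, which happens iff some concept is consistent with no observation.\<close>

definition MAP_TD_learner ::
  "ordering \<Rightarrow> replacement \<Rightarrow> 'c set \<Rightarrow> 'z set \<Rightarrow> ('c, 'z) learner \<Rightarrow> enat" where
  "MAP_TD_learner \<alpha> \<beta> C Z L = Inf {enat (teacher_order C T) | T. teacher \<alpha> \<beta> C Z L T}"

definition MAP_TD ::
  "ordering \<Rightarrow> replacement \<Rightarrow> 'c set \<Rightarrow> 'z set \<Rightarrow> ('c \<times> 'z) set \<Rightarrow> enat" where
  "MAP_TD \<alpha> \<beta> C Z R = Inf {MAP_TD_learner \<alpha> \<beta> C Z L | L. MAP_learner C Z R L}"

end

theory Submission imports Defs begin

text \<open>A MAP-learner for the smaller observation set becomes one for the larger set when its
  likelihoods are extended by zero. This changes neither the supports nor the probabilities of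
  samples over the smaller set, so every teacher remains a teacher of the same order.\<close>

lemma samples_mono: "Z \<subseteq> Z' \<Longrightarrow> samples \<alpha> \<beta> Z \<subseteq> samples \<alpha> \<beta> Z'"
  by (cases \<alpha>; cases \<beta>) auto

lemma prob_seq_repl_cong:
  assumes "\<And>z. z \<in> set zs \<Longrightarrow> q z = q' z"
  shows "prob_seq_repl q zs = prob_seq_repl q' zs"
  using assms by (simp add: prob_seq_repl_def)

lemma prob_mset_repl_cong:
  assumes "\<And>z. z \<in># A \<Longrightarrow> q z = q' z"
  shows "prob_mset_repl q A = prob_mset_repl q' A"
  using assms by (simp add: prob_mset_repl_def)

text \<open>Each denominator subtracts only the mass of entries drawn earlier in \<open>zs\<close>,
  so no value of \<open>q\<close> off the list enters.\<close>

lemma prob_seq_norepl_cong: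
  assumes "\<And>z. z \<in> set zs \<Longrightarrow> q z = q' z"
  shows "prob_seq_norepl q zs = prob_seq_norepl q' zs"
  using assms by (simp add: prob_seq_norepl_def)

lemma prob_set_norepl_cong:
  assumes "\<And>z. z \<in> A \<Longrightarrow> q z = q' z"
  shows "prob_set_norepl q A = prob_set_norepl q' A"
  unfolding prob_set_norepl_def
  by (intro sum.cong refl prob_seq_norepl_cong assms) (auto simp: permutations_of_set_def)

text \<open>Membership in \<open>samples\<close> fixes the constructor of \<open>S\<close> and
  confines its entries to \<open>Z\<close>, so each mode falls under one of the four congruences
  above.\<close>

lemma sample_prob_cong:
  assumes "S \<in> samples \<alpha> \<beta> Z" and "\<And>z. z \<in> Z \<Longrightarrow> q z = q' z"
  shows "sample_prob \<alpha> \<beta> q S = sample_prob \<alpha> \<beta> q' S"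
  using assms(1)
  by (cases \<alpha>; cases \<beta>)
    (auto intro!: prob_seq_repl_cong prob_mset_repl_cong prob_seq_norepl_cong prob_set_norepl_cong
      assms(2))

text \<open>The values of \<open>lik L\<close> off \<open>Z\<close> are arbitrary, so the zeros have
  to be written in explicitly.\<close>

definition extend_learner :: "'z set \<Rightarrow> ('c, 'z) learner \<Rightarrow> ('c, 'z) learner" where
  "extend_learner Z L = L\<lparr>lik := \<lambda>c z. if z \<in> Z then lik L c z else 0\<rparr>"

lemma prior_extend_learner [simp]: "prior (extend_learner Z L) = prior L"
  by (simp add: extend_learner_def)

lemma lik_extend_learner [simp]:
  "lik (extend_learner Z L) c z = (if z \<in> Z then lik L c z else 0)"
  by (simp add: extend_learner_def)

text \<open>On \<open>Z\<close>, inconsistency under \<open>R'\<close> forces inconsistency under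
  \<open>R\<close>, where \<open>L\<close> already assigns 0; off \<open>Z\<close> the likelihood is
  0 by construction.\<close>

lemma MAP_learner_extend_learner:
  assumes "MAP_learner C Z R L" and "finite Z'" and "Z \<subseteq> Z'"
    and "\<And>c z. c \<in> C \<Longrightarrow> z \<in> Z \<Longrightarrow> (c, z) \<in> R \<Longrightarrow> (c, z) \<in> R'"
  shows "MAP_learner C Z' R' (extend_learner Z L)"
proof -
  have "(\<Sum>z\<in>Z'. lik (extend_learner Z L) c z) = (\<Sum>z\<in>Z. lik L c z)" for c
    using assms(2,3) by (simp add: sum.If_cases Int_absorb1)
  with assms(1,4) show ?thesis
    unfolding MAP_learner_def by (auto, blast)
qed

text \<open>This preserves the size bound on samples without replacement.\<close>

lemma N_plus_extend_learner:
  assumes "Z \<subseteq> Z'"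
  shows "N_plus C Z' (extend_learner Z L) = N_plus C Z L"
proof -
  have "{z \<in> Z'. lik (extend_learner Z L) c z > 0} = {z \<in> Z. lik L c z > 0}" for c
    using assms by auto
  then show ?thesis
    by (simp add: N_plus_def)
qed

lemma teacher_extend_learner:
  assumes "teacher \<alpha> \<beta> C Z L T" and "Z \<subseteq> Z'"
  shows "teacher \<alpha> \<beta> C Z' (extend_learner Z L) T"
proof -
  \<comment> \<open>Here \<open>c\<close> is unrestricted, so that the whole function maximized in
    \<open>is_arg_max\<close> can be rewritten; \<open>c\<^sub>0 \<in> C\<close> ensures that
    \<open>T c\<^sub>0\<close> is a sample over \<open>Z\<close>.\<close>
  have "sample_prob \<alpha> \<beta> (lik (extend_learner Z L) c) (T c\<^sub>0) = sample_prob \<alpha> \<beta> (lik L c) (T c\<^sub>0)"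
    if "c\<^sub>0 \<in> C" for c c\<^sub>0
    using assms(1) that by (intro sample_prob_cong[where Z = Z]) (auto simp: teacher_def)
  then show ?thesis
    using assms
    by (auto simp: teacher_def N_plus_extend_learner simp del: lik_extend_learner
        intro: subsetD[OF samples_mono])
qed

lemma MAP_TD_learner_extend_learner:
  assumes "Z \<subseteq> Z'"
  shows "MAP_TD_learner \<alpha> \<beta> C Z' (extend_learner Z L) \<le> MAP_TD_learner \<alpha> \<beta> C Z L"
  unfolding MAP_TD_learner_def
  \<comment> \<open>The same \<open>T\<close> witnesses the same order, so the set of orders can
    only grow and its infimum can only drop.\<close>
  by (rule Inf_superset_mono) (use teacher_extend_learner[OF _ assms] in blast)

theorem corollary3p9:
  fixes C :: "'c set" and Z Z' :: "'z set" and R R' :: "('c \<times> 'z) set"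
    and \<alpha> :: ordering and \<beta> :: replacement
  assumes "concept_class_triple C Z R"
    and "concept_class_triple C Z' R'"
    and "Z \<subseteq> Z'"
    and "\<And>c z. c \<in> C \<Longrightarrow> z \<in> Z \<Longrightarrow> (c, z) \<in> R \<longleftrightarrow> (c, z) \<in> R'"
  shows "MAP_TD \<alpha> \<beta> C Z R \<ge> MAP_TD \<alpha> \<beta> C Z' R'"
proof -
  have "MAP_TD \<alpha> \<beta> C Z' R' \<le> MAP_TD_learner \<alpha> \<beta> C Z L" if "MAP_learner C Z R L" for L
  proof -
    have "MAP_learner C Z' R' (extend_learner Z L)"
      using that assms(2-4)
      by (intro MAP_learner_extend_learner[where R = R]) (simp_all add: concept_class_triple_def)
    then have "MAP_TD \<alpha> \<beta> C Z' R' \<le> MAP_TD_learner \<alpha> \<beta> C Z' (extend_learner Z L)"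
      unfolding MAP_TD_def by (intro Inf_lower) blast
    also have "\<dots> \<le> MAP_TD_learner \<alpha> \<beta> C Z L"
      using assms(3) by (rule MAP_TD_learner_extend_learner)
    finally show ?thesis .
  qed
  \<comment> \<open>A lower bound for every \<open>L\<close> also settles the case without any
    learner on \<open>Z\<close>, where the infimum is infinite.\<close>
  then show ?thesis
    unfolding MAP_TD_def[of \<alpha> \<beta> C Z R] by (intro Inf_greatest) blast
qed

end
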